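(* Let $K$ be a positive (i.e. $K\ge 0$), rapidly decaying kernel on $\mathbb{R}^d$ of unit mass, and let $\phi:\mathbb{R}^d\to\mathbb{R}$ be continuous and bounded. Then for every $\lambda\in\mathbb{R}$, $$\mathbf{S}_K\,\mathbf{T}_\lambda\phi=\mathbf{T}_\lambda\,\mathbf{M}_K\phi,$$ and therefore, for every $x\in\mathbb{R}^d$, $$\mathbf{M}_K\phi(x)=\sup\{\lambda\in\mathbb{R} : x\in \mathbf{S}_K\mathbf{T}_\lambda\phi\}.$$
   Context: The kernel $K$ is a nonnegative function on $\mathbb{R}^d$ decaying rapidly at infinity (faster than any power of $|x|$) with $\int_{\mathbb{R}^d}K=1$; one also allows $K$ to be a singular kernel, namely a finite positive combination of surface measures on spheres centered at $0$ with total mass $1$, in which case $\int_A K(x-y)\,dy$ means the $K$-measure of $x-A$. For a function $\phi:\mathbb{R}^d\to\mathbb{R}$ and $\lambda\in\mathbb{R}$, $\mathbf{T}_\lambda\phi=\{x\in\mathbb{R}^d:\phi(x)\ge\lambda\}$ (super level set). For bounded continuous $\phi$, set $\psi_K\phi(x,\lambda)=\int_{\mathbf{T}_\lambda\phi}K(x-y)\,dy$, and define the weighted median of $\phi$ at $x$ with weight $K$ by $$\mathbf{M}_K\phi(x)=\sup\{\lambda\in\mathbb{R}:\psi_K\phi(x,\lambda)\ge\tfrac12\}.$$ For a set $\Sigma\subseteq\mathbb{R}^d$ (measurable), one step of threshold dynamics is $$\mathbf{S}_K\Sigma=\{x\in\mathbb{R}^d: (K*\mathbf{1}_\Sigma)(x)\ge\tfrac12\},$$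 where $(K*\mathbf{1}_\Sigma)(x)=\int_\Sigma K(x-y)\,dy$. *)

theory Defs
  imports "HOL-Analysis.Analysis"
begin

(* Surface measure on the sphere of radius r > 0 centered at 0, as a Borel measure on the
   whole space, given by the cone formula
     sigma_r(A) = d * r^(d-1) * |{x. 0 < |x| < 1 and r x/|x| in A}|.
   Its total mass is the surface area d * |unit ball| * r^(d-1); for d = 1 it is the counting
   measure on {-r, r}. *)
definition sphere_measure :: "real \<Rightarrow> 'a::euclidean_space measure" where
  "sphere_measure r =
     scale_measure (ennreal (real DIM('a) * r ^ (DIM('a) - 1)))
       (distr (restrict_space lborel (ball 0 1 - {0})) borel (\<lambda>x. (r / norm x) *\<^sub>R x))"

datatype 'a kernel = Regular "'a \<Rightarrow> real" | Singular "'a measure"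

definition rapidly_decaying :: "('a::real_normed_vector \<Rightarrow> real) \<Rightarrow> bool" where
  "rapidly_decaying k \<longleftrightarrow> (\<forall>n::nat. ((\<lambda>x. norm x ^ n * k x) \<longlongrightarrow> 0) at_infinity)"

(* For singular kernels, rapid decay needs no separate condition: the measure is supported on
   finitely many spheres. *)
fun is_kernel :: "'a::euclidean_space kernel \<Rightarrow> bool" where
  "is_kernel (Regular k) \<longleftrightarrow>
     (\<forall>x. 0 \<le> k x) \<and> rapidly_decaying k \<and> has_bochner_integral lebesgue k 1"
| "is_kernel (Singular \<mu>) \<longleftrightarrow>
     sets \<mu> = sets borel \<and> emeasure \<mu> UNIV = 1 \<and>
     (\<exists>R c. finite R \<and> (\<forall>r\<in>R. 0 < r \<and> 0 < c r) \<and>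
        (\<forall>A\<in>sets borel. emeasure \<mu> A = (\<Sum>r\<in>R. ennreal (c r) * emeasure (sphere_measure r) A)))"

(* The convolution (K * 1_A)(x), i.e. the integral of K(x - y) over y in A; for singular kernels
   this is the K-measure of x - A. *)
fun kernel_conv :: "'a::euclidean_space kernel \<Rightarrow> 'a set \<Rightarrow> 'a \<Rightarrow> real" where
  "kernel_conv (Regular k) A x = (LINT y:A|lebesgue. k (x - y))"
| "kernel_conv (Singular \<mu>) A x = measure \<mu> ((\<lambda>y. x - y) ` A)"

definition superlevel :: "real \<Rightarrow> ('a \<Rightarrow> real) \<Rightarrow> 'a set" where
  "superlevel t \<phi> = {x. \<phi> x \<ge> t}"

definition psi :: "'a::euclidean_space kernel \<Rightarrow> ('a \<Rightarrow> real) \<Rightarrow> 'a \<Rightarrow> real \<Rightarrow> real" where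
  "psi K \<phi> x t = kernel_conv K (superlevel t \<phi>) x"

(* For bounded measurable \<phi> and a kernel K the set below is nonempty and bounded above, so the
   real-valued Sup is the true supremum. *)
definition weighted_median :: "'a::euclidean_space kernel \<Rightarrow> ('a \<Rightarrow> real) \<Rightarrow> 'a \<Rightarrow> real" where
  "weighted_median K \<phi> x = Sup {t. psi K \<phi> x t \<ge> 1/2}"

definition threshold_step :: "'a::euclidean_space kernel \<Rightarrow> 'a set \<Rightarrow> 'a set" where
  "threshold_step K \<Sigma> = {x. kernel_conv K \<Sigma> x \<ge> 1/2}"

end

(* For fixed x, the map t -> (K * 1_{phi >= t})(x) is t -> M {phi >= t} for a probability
   measure M (the law of x - Z with Z distributed according to K).  It is antitone, equal to 1
   for very negative t and to 0 for large t, and left-continuous since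
   {phi >= s} is the decreasing limit of {phi >= s - 1/n}.  Hence the set where it is at least 1/2
   is a closed half-line ending at its supremum, the weighted median at x. *)
theory Submission imports Defs begin

text \<open>Reflection is the affine map with every diagonal coefficient -1, so its Jacobian factor
  is a product of ones in absolute value.\<close>

lemma distr_lebesgue_reflect:
  fixes x :: "'a::euclidean_space"
  shows "(\<lambda>y. x - y) \<in> lebesgue \<rightarrow>\<^sub>M lebesgue"
    and "distr lebesgue lebesgue (\<lambda>y. x - y) = lebesgue"
proof -
  have T: "(\<lambda>y. x + (\<Sum>j\<in>Basis. ((-1) * (y \<bullet> j)) *\<^sub>R j)) = (\<lambda>y. x - y)"
    by (simp add: fun_eq_iff sum_negf euclidean_representation)
  show "(\<lambda>y. x - y) \<in> lebesgue \<rightarrow>\<^sub>M lebesgue"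
    using lebesgue_affine_measurable[of "\<lambda>_. -1" x] unfolding T by simp
  show "distr lebesgue lebesgue (\<lambda>y. x - y) = lebesgue"
    using lebesgue_affine_euclidean[of "\<lambda>_. -1" x] unfolding T by (simp add: density_1)
qed

lemma has_bochner_integral_lebesgue_reflect:
  fixes k :: "'a::euclidean_space \<Rightarrow> real"
  assumes "has_bochner_integral lebesgue k i"
  shows "has_bochner_integral lebesgue (\<lambda>y. k (x - y)) i"
proof -
  have "k \<in> borel_measurable lebesgue"
    using assms by (simp add: has_bochner_integral_iff borel_measurable_integrable)
  then show ?thesis
    using assms integrable_distr_eq[OF distr_lebesgue_reflect(1)[of x], of k]
      integral_distr[OF distr_lebesgue_reflect(1)[of x], of k]
    unfolding distr_lebesgue_reflect(2) has_bochner_integral_iff by simp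
qed

text \<open>Puts both kinds of kernel into one form, so that the rest is plain measure theory. The
  measure depends on \<open>x\<close>. It lives on the Lebesgue sets for a regular kernel and on the
  Borel sets for a singular one, hence only an inclusion of sigma-algebras.\<close>

lemma kernel_conv_eq_measure:
  fixes K :: "'a::euclidean_space kernel"
  assumes "is_kernel K"
  obtains M :: "'a measure" where "finite_measure M" "space M = UNIV" "sets borel \<subseteq> sets M"
    "measure M UNIV = 1" "\<And>A. A \<in> sets borel \<Longrightarrow> kernel_conv K A x = measure M A"
proof (cases K)
  case (Regular k)
  define M where "M = density lebesgue (\<lambda>y. ennreal (k (x - y)))"
  have nn: "0 \<le> k y" for y using assms Regular by simp
  have bi: "has_bochner_integral lebesgue (\<lambda>y. k (x - y)) 1"
    using assms Regular by (simp add: has_bochner_integral_lebesgue_reflect)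
  have meas: "(\<lambda>y. k (x - y)) \<in> borel_measurable lebesgue"
    using bi by (simp add: has_bochner_integral_iff borel_measurable_integrable)
  have em: "emeasure M A = ennreal (kernel_conv K A x)" if A: "A \<in> sets lebesgue" for A
  proof -
    have "integrable lebesgue (\<lambda>y. indicator A y *\<^sub>R k (x - y))"
      using bi A by (intro integrable_mult_indicator) (auto simp: has_bochner_integral_iff)
    then have "ennreal (kernel_conv K A x) = (\<integral>\<^sup>+y. ennreal (indicator A y *\<^sub>R k (x - y)) \<partial>lebesgue)"
      unfolding Regular kernel_conv.simps set_lebesgue_integral_def
      by (intro nn_integral_eq_integral[symmetric]) (auto simp: nn)
    also have "\<dots> = emeasure M A"
      unfolding M_def using meas A
      by (subst emeasure_density) (auto intro!: nn_integral_cong simp: indicator_def)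
    finally show ?thesis by simp
  qed
  \<comment> \<open>Passing from \<open>emeasure\<close> back to the real \<open>measure\<close>
    would truncate a negative value to 0; the sign excludes this.\<close>
  have nnc: "0 \<le> kernel_conv K A x" for A
    unfolding Regular kernel_conv.simps set_lebesgue_integral_def by (simp add: nn)
  have 1: "kernel_conv K UNIV x = 1"
    using bi by (simp add: Regular set_lebesgue_integral_def has_bochner_integral_iff)
  have space: "space M = UNIV" by (simp add: M_def)
  show ?thesis
  proof
    show "finite_measure M" by (rule finite_measureI) (simp add: space em)
    show "measure M UNIV = 1" by (simp add: measure_def em 1)
    show "sets borel \<subseteq> sets M" by (auto simp: M_def)
    show "kernel_conv K A x = measure M A" if "A \<in> sets borel" for A
      using that by (simp add: measure_def em nnc)
  qed (rule space)
next
  case (Singular \<mu>)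
  have s: "sets \<mu> = sets borel" and 1: "emeasure \<mu> UNIV = 1" using assms Singular by auto
  have sp: "space \<mu> = UNIV" using sets_eq_imp_space_eq[OF s] by simp
  have [measurable]: "(\<lambda>y. x - y) \<in> \<mu> \<rightarrow>\<^sub>M borel"
    unfolding measurable_cong_sets[OF s refl] by measurable
  define M where "M = distr \<mu> borel (\<lambda>y. x - y)"
  have em: "emeasure M A = emeasure \<mu> ((\<lambda>y. x - y) -` A)" if "A \<in> sets borel" for A
    using that by (simp add: M_def emeasure_distr sp)
  \<comment> \<open>The reflection is an involution. This matches the image in
    \<open>kernel_conv\<close> with the preimage in \<open>distr\<close>.\<close>
  have im: "(\<lambda>y. x - y) ` A = (\<lambda>y. x - y) -` A" for A
    by force
  show ?thesis
  proof
    show "finite_measure M" by (rule finite_measureI) (simp add: M_def em[unfolded M_def] 1)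
    show "space M = UNIV" "sets borel \<subseteq> sets M" by (simp_all add: M_def)
    show "measure M UNIV = 1" by (simp add: measure_def em 1)
    show "kernel_conv K A x = measure M A" if "A \<in> sets borel" for A
      using that by (simp add: Singular measure_def em im)
  qed
qed

text \<open>From right to left, the supremum is an upper bound. From left to right, the supremum is
  attained, and smaller levels have larger superlevel sets. The two bounds on \<open>p\<close> make
  the set bounded above and nonempty, so \<open>Sup\<close> is a true supremum.\<close>

lemma le_Sup_measure_superlevel_iff:
  fixes \<phi> :: "'a \<Rightarrow> real"
  assumes "finite_measure M" and meas: "\<And>t. superlevel t \<phi> \<in> sets M"
    and bdd: "bounded (range \<phi>)" and p: "0 < p" "p \<le> measure M UNIV"
  shows "t \<le> Sup {t. p \<le> measure M (superlevel t \<phi>)} \<longleftrightarrow> p \<le> measure M (superlevel t \<phi>)"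
proof -
  interpret finite_measure M by fact
  let ?S = "{t. p \<le> measure M (superlevel t \<phi>)}"
  obtain B where B: "\<bar>\<phi> y\<bar> \<le> B" for y
    using bdd by (auto simp: bounded_iff)
  have anti: "measure M (superlevel t \<phi>) \<le> measure M (superlevel s \<phi>)" if "s \<le> t" for s t
    using that meas by (intro finite_measure_mono) (auto simp: superlevel_def)
  have "superlevel (-B) \<phi> = UNIV" using B by (auto simp: superlevel_def abs_le_iff minus_le_iff)
  then have ne: "-B \<in> ?S" using p by simp
  have ub: "s \<le> B" if "s \<in> ?S" for s
  proof (rule ccontr)
    assume "\<not> s \<le> B"
    then have "\<phi> y < s" for y using B[of y] by linarith
    then have "superlevel s \<phi> = {}" by (simp add: superlevel_def not_le)
    then show False using that p by simp
  qed
  have ba: "bdd_above ?S" using ub by (rule bdd_aboveI)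
  \<comment> \<open>Levels strictly below the supremum: \<open>Suc n\<close> matters, since
    \<open>1 / 0 = 0\<close> would start at the supremum itself, where the bound by \<open>p\<close>
    is still to be shown.\<close>
  define A where "A n = superlevel (Sup ?S - 1 / real (Suc n)) \<phi>" for n
  have "decseq A"
    by (auto simp: decseq_def A_def superlevel_def frac_le intro: order_trans[rotated])
  moreover have "range A \<subseteq> sets M" using meas by (auto simp: A_def)
  ultimately have "(\<lambda>n. measure M (A n)) \<longlonglongrightarrow> measure M (\<Inter>n. A n)"
    by (rule finite_Lim_measure_decseq[rotated])
  moreover have "(\<Inter>n. A n) = superlevel (Sup ?S) \<phi>"
  proof -
    have "Sup ?S \<le> \<phi> y" if "\<And>n. Sup ?S - 1 / real (Suc n) \<le> \<phi> y" for y
    proof (rule LIMSEQ_le_const2)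
      show "(\<lambda>n. Sup ?S - 1 / real (Suc n)) \<longlonglongrightarrow> Sup ?S"
        using tendsto_diff[OF tendsto_const LIMSEQ_inverse_real_of_nat, of "Sup ?S"]
        by (simp add: inverse_eq_divide)
    qed (use that in auto)
    moreover have "Sup ?S - 1 / real (Suc n) \<le> \<phi> y" if "Sup ?S \<le> \<phi> y" for y n
      using that by (rule order_trans[rotated]) simp
    ultimately show ?thesis
      unfolding A_def superlevel_def by blast
  qed
  moreover have "p \<le> measure M (A n)" for n
  proof -
    \<comment> \<open>Some admissible level \<open>s\<close> lies above this one, and its superlevel
      set is contained in \<open>A n\<close>.\<close>
    have "Sup ?S - 1 / real (Suc n) < Sup ?S" by simp
    then obtain s where "s \<in> ?S" "Sup ?S - 1 / real (Suc n) < s"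
      using less_cSup_iff[OF _ ba] ne by blast
    then show ?thesis using anti[of "Sup ?S - 1 / real (Suc n)" s] by (simp add: A_def)
  qed
  ultimately have "p \<le> measure M (superlevel (Sup ?S) \<phi>)"
    using LIMSEQ_le_const by metis
  then show ?thesis
    using anti[of t "Sup ?S"] cSup_upper[OF _ ba, of t] by auto
qed

theorem lemma1:
  fixes K :: "'a::euclidean_space kernel" and \<phi> :: "'a \<Rightarrow> real"
  assumes "is_kernel K"
    and "continuous_on UNIV \<phi>" and "bounded (range \<phi>)"
  shows "(\<forall>t. threshold_step K (superlevel t \<phi>) = superlevel t (weighted_median K \<phi>)) \<and>
         (\<forall>x. weighted_median K \<phi> x = Sup {t. x \<in> threshold_step K (superlevel t \<phi>)})"
proof -
  \<comment> \<open>Continuity enters only here: the superlevel sets are closed.\<close>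
  have borel: "superlevel t \<phi> \<in> sets borel" for t
    using assms(2) unfolding superlevel_def
    by (intro borel_closed closed_Collect_le) auto
  have "t \<le> weighted_median K \<phi> x \<longleftrightarrow> 1/2 \<le> kernel_conv K (superlevel t \<phi>) x" for t x
  proof -
    obtain M where M: "finite_measure M" "space M = UNIV" "sets borel \<subseteq> sets M"
      "measure M UNIV = 1" "\<And>A. A \<in> sets borel \<Longrightarrow> kernel_conv K A x = measure M A"
      using kernel_conv_eq_measure[OF assms(1)] by metis
    show ?thesis
      using le_Sup_measure_superlevel_iff[OF M(1) _ assms(3), of "1/2" t] M(3,4) borel
      by (auto simp: weighted_median_def psi_def M(5))
  qed
  \<comment> \<open>Read at fixed \<open>t\<close>, the equivalence is the equality of sets; the
    formula for the median only unfolds \<open>threshold_step\<close> inside its defining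
    supremum.\<close>
  then show ?thesis
    by (auto simp: threshold_step_def superlevel_def weighted_median_def psi_def)
qed

end
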